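(* Let $n\ge1$ and let $\Bbbk$ be a field. The Cartan matrix of $\Bbbk\,\mathcal{EF}_n$ is a $2^n\times2^n$ matrix, with rows and columns indexed by the subsets of $[n]$. Given $A,B\subseteq[n]$, the $(B,A)$ entry of the Cartan matrix is $$\sum_{X\subseteq B}(-1)^{|B|-|X|}\prod_{i\in A}|X_{\le i}| .$$
   Context: $[n]=\{1,\dots,n\}$. For $X\subseteq[n]$ and $i\in[n]$, $X_{\le i}=\{x\in X\mid x\le i\}$. $\mathcal{EF}_n$ is the category whose objects are all subsets of $[n]$ and whose morphisms $A\to B$ are the onto functions $f$ with domain $A$ and range $B$ that are order-decreasing ($f(x)\le x$ for all $x\in A$). The category algebra $\Bbbk\mathcal{EF}_n$ has basis the morphisms, with product $m'\cdot m=m'm$ if the composition is defined and $0$ otherwise. The identity morphisms $1_A$, $A\subseteq[n]$, form a complete set of primitive orthogonal idempotents of $\Bbbk\mathcal{EF}_n$, and $\Bbbk\mathcal{EF}_n$ is split basic (its quotient by the radical is a direct product of copies of $\Bbbk$). For a split basic algebra $\Lambda$ with complete set of primitive orthogonal idempotents $(e_i)$, the Cartan matrix has $(i,j)$ entry $\dim_\Bbbk e_i\Lambda e_j$; here the index $A\subseteq[n]$ corresponds to the idempotent $1_A$. *)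

theory Defs
  imports Complex_Main "HOL-Library.FuncSet" "HOL-Library.Poly_Mapping"
begin

record ('o, 'm) category =
  Obj :: "'o set"
  Mor :: "'m set"
  Dom :: "'m \<Rightarrow> 'o"
  Cod :: "'m \<Rightarrow> 'o"
  Id :: "'o \<Rightarrow> 'm"
  Comp :: "'m \<Rightarrow> 'm \<Rightarrow> 'm"

(* Comp C g f means "g after f" and is only meaningful if Dom C g = Cod C f. *)
definition is_category :: "('o, 'm) category \<Rightarrow> bool" where
  "is_category C \<longleftrightarrow>
     (\<forall>f\<in>Mor C. Dom C f \<in> Obj C \<and> Cod C f \<in> Obj C) \<and>
     (\<forall>X\<in>Obj C. Id C X \<in> Mor C \<and> Dom C (Id C X) = X \<and> Cod C (Id C X) = X) \<and>
     (\<forall>f\<in>Mor C. \<forall>g\<in>Mor C. Dom C g = Cod C f \<longrightarrow>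
        Comp C g f \<in> Mor C \<and> Dom C (Comp C g f) = Dom C f \<and> Cod C (Comp C g f) = Cod C g) \<and>
     (\<forall>f\<in>Mor C. Comp C f (Id C (Dom C f)) = f \<and> Comp C (Id C (Cod C f)) f = f) \<and>
     (\<forall>f\<in>Mor C. \<forall>g\<in>Mor C. \<forall>h\<in>Mor C. Dom C g = Cod C f \<longrightarrow> Dom C h = Cod C g \<longrightarrow>
        Comp C h (Comp C g f) = Comp C (Comp C h g) f)"

(* A morphism A \<rightarrow> B is the triple (A, f, B); since f is only a function on A, it is
   represented by its extensional version, so that equal functions give equal triples. *)
type_synonym ef_mor = "nat set \<times> (nat \<Rightarrow> nat) \<times> nat set"

definition EF :: "nat \<Rightarrow> (nat set, ef_mor) category" where
  "EF n = \<lparr>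
     Obj = Pow {1..n},
     Mor = {(A, f, B). A \<subseteq> {1..n} \<and> B \<subseteq> {1..n} \<and>
              f \<in> extensional A \<and> f ` A = B \<and> (\<forall>x\<in>A. f x \<le> x)},
     Dom = (\<lambda>(A, f, B). A),
     Cod = (\<lambda>(A, f, B). B),
     Id = (\<lambda>A. (A, restrict id A, A)),
     Comp = (\<lambda>(B', g, C) (A, f, B). (A, compose A g f, C)) \<rparr>"

lemma is_category_EF: "is_category (EF n)"
proof -
  have "compose A h (compose A g f) = compose A (compose B h g) f" if "f ` A = B"
    for A B :: "nat set" and f g h
    using that by (auto simp: compose_def restrict_def fun_eq_iff)
  moreover have "compose A f (restrict id A) = f" "compose A (restrict id B) f = f"
    if "f \<in> extensional A" "f ` A = B" for A B :: "nat set" and f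
    using that by (auto simp: compose_def restrict_def extensional_def fun_eq_iff)
  moreover have "compose A g f ` A = g ` f ` A" for A :: "nat set" and g f :: "nat \<Rightarrow> nat"
    by (auto simp: compose_def)
  moreover have "compose A g f x \<le> x"
    if "\<forall>x\<in>A. f x \<le> x" "\<forall>x\<in>f ` A. g x \<le> x" "x \<in> A" for A :: "nat set" and f g x
    using that by (force simp: compose_def intro: order_trans)
  ultimately show ?thesis
    unfolding is_category_def EF_def by (auto simp: compose_def)
qed

(* Linear combinations of morphisms are finitely supported functions on the type of
   morphisms; those supported in Mor C form the category algebra. *)
definition cat_alg :: "('o, 'm) category \<Rightarrow> ('m \<Rightarrow>\<^sub>0 'k::field) set" where
  "cat_alg C = {x. Poly_Mapping.keys x \<subseteq> Mor C}"

definition cat_alg_scale :: "'k::field \<Rightarrow> ('m \<Rightarrow>\<^sub>0 'k) \<Rightarrow> ('m \<Rightarrow>\<^sub>0 'k)" where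
  "cat_alg_scale c x = Poly_Mapping.map ((*) c) x"

(* The bilinear extension of m' \<cdot> m = m' m if the composition is defined, and 0 otherwise. *)
definition cat_alg_mult ::
    "('o, 'm) category \<Rightarrow> ('m \<Rightarrow>\<^sub>0 'k::field) \<Rightarrow> ('m \<Rightarrow>\<^sub>0 'k) \<Rightarrow> ('m \<Rightarrow>\<^sub>0 'k)" where
  "cat_alg_mult C x y =
     (\<Sum>m'\<in>Poly_Mapping.keys x. \<Sum>m\<in>Poly_Mapping.keys y.
        if Dom C m' = Cod C m
        then Poly_Mapping.single (Comp C m' m) (Poly_Mapping.lookup x m' * Poly_Mapping.lookup y m)
        else 0)"

definition cat_alg_idem :: "('o, 'm) category \<Rightarrow> 'o \<Rightarrow> ('m \<Rightarrow>\<^sub>0 'k::field)" where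
  "cat_alg_idem C X = Poly_Mapping.single (Id C X) 1"

lemma lookup_cat_alg_scale:
  "Poly_Mapping.lookup (cat_alg_scale c x) m = c * Poly_Mapping.lookup x m"
  by (simp add: cat_alg_scale_def Poly_Mapping.map.rep_eq when_def)

lemma vector_space_cat_alg_scale:
  "vector_space (cat_alg_scale :: 'k::field \<Rightarrow> ('m \<Rightarrow>\<^sub>0 'k) \<Rightarrow> _)"
  by unfold_locales
     (auto simp: lookup_cat_alg_scale lookup_add algebra_simps intro!: poly_mapping_eqI)

lemma cat_alg_idem_mult:
  assumes "is_category C" "X \<in> Obj C" "Y \<in> Obj C"
  shows "cat_alg_mult C (cat_alg_idem C X) (cat_alg_idem C Y :: 'm \<Rightarrow>\<^sub>0 'k::field) =
           (if X = Y then cat_alg_idem C X else 0)"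
proof -
  have d: "Dom C (Id C Z) = Z" "Cod C (Id C Z) = Z" "Id C Z \<in> Mor C" if "Z \<in> Obj C" for Z
    using assms(1) that by (auto simp: is_category_def)
  have "Comp C (Id C X) (Id C X) = Id C X"
    using assms(1) d[OF assms(2)] unfolding is_category_def by metis
  then show ?thesis
    using d assms(2,3) by (auto simp: cat_alg_mult_def cat_alg_idem_def)
qed

(* The Cartan matrix of a split basic algebra L, with scalar multiplication scale and
   product mult, with respect to a complete set (e i), i \<in> I, of primitive orthogonal
   idempotents: the I \<times> I matrix with (i, j) entry dim (e i L e j). *)
definition cartan_matrix ::
    "('k::field \<Rightarrow> 'a::ab_group_add \<Rightarrow> 'a) \<Rightarrow> ('a \<Rightarrow> 'a \<Rightarrow> 'a) \<Rightarrow> 'a set \<Rightarrow>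
     'i set \<Rightarrow> ('i \<Rightarrow> 'a) \<Rightarrow> 'i \<times> 'i \<Rightarrow> nat" where
  "cartan_matrix scale mult L I e =
     (\<lambda>(i, j)\<in>I \<times> I. vector_space.dim scale {mult (mult (e i) x) (e j) |x. x \<in> L})"

definition cat_alg_cartan_matrix ::
    "'k::field itself \<Rightarrow> ('o, 'm) category \<Rightarrow> 'o \<times> 'o \<Rightarrow> nat" where
  "cat_alg_cartan_matrix _ C =
     cartan_matrix cat_alg_scale (cat_alg_mult C) (cat_alg C :: ('m \<Rightarrow>\<^sub>0 'k) set)
       (Obj C) (cat_alg_idem C)"

end

theory Submission
  imports Defs
begin

text \<open>
  Multiplying by \<open>1\<^sub>B\<close> on the left and by \<open>1\<^sub>A\<close> on the right keeps exactly the morphisms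
  \<open>A \<rightarrow> B\<close> of a linear combination, so the Cartan matrix of a category algebra counts
  morphisms. The order-decreasing functions on \<open>A\<close> with range contained in \<open>X\<close> number
  \<open>\<Prod>i\<in>A. |X\<^sub>\<le>\<^sub>i|\<close>, and Moebius inversion over the subsets of \<open>B\<close> isolates those with
  range exactly \<open>B\<close>.
\<close>

definition Hom :: "('o, 'm) category \<Rightarrow> 'o \<Rightarrow> 'o \<Rightarrow> 'm set" where
  "Hom C X Y = {m \<in> Mor C. Dom C m = X \<and> Cod C m = Y}"

text \<open>The identity at \<open>Y\<close> composes exactly with the morphisms of codomain
  \<open>Y\<close>, and it fixes them. Since the identity law holds only on \<open>Mor C\<close>,
  \<open>x\<close> must lie in the category algebra.\<close>

lemma lookup_cat_alg_idem_mult: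
  fixes x :: "'m \<Rightarrow>\<^sub>0 'k::field"
  assumes C: "is_category C" and Y: "Y \<in> Obj C" and x: "x \<in> cat_alg C"
  shows "Poly_Mapping.lookup (cat_alg_mult C (cat_alg_idem C Y) x) m =
    (if Cod C m = Y then Poly_Mapping.lookup x m else 0)"
proof -
  have D: "Dom C (Id C Y) = Y"
    using C Y by (auto simp: is_category_def)
  have I: "Comp C (Id C Y) k = k" if "k \<in> Poly_Mapping.keys x" "Cod C k = Y" for k
    using C x that by (auto simp: is_category_def cat_alg_def)
  have "cat_alg_mult C (cat_alg_idem C Y) x =
      (\<Sum>k\<in>Poly_Mapping.keys x.
        if Dom C (Id C Y) = Cod C k then Poly_Mapping.single (Comp C (Id C Y) k) (Poly_Mapping.lookup x k) else 0)"
    unfolding cat_alg_mult_def cat_alg_idem_def keys_single by (simp cong: if_cong)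
  also have "\<dots> =
      (\<Sum>k\<in>Poly_Mapping.keys x.
        if Cod C k = Y then Poly_Mapping.single k (Poly_Mapping.lookup x k) else 0)"
    by (intro sum.cong) (auto simp: D I)
  finally have "Poly_Mapping.lookup (cat_alg_mult C (cat_alg_idem C Y) x) m =
      (\<Sum>k\<in>Poly_Mapping.keys x.
        if k = m then if Cod C m = Y then Poly_Mapping.lookup x m else 0 else 0)"
    by (simp only: lookup_sum, intro sum.cong) (auto simp: lookup_single)
  \<comment> \<open>If \<open>m\<close> is not a key of \<open>x\<close>, every summand vanishes, in
    agreement with its coefficient 0.\<close>
  then show ?thesis
    by (auto simp: in_keys_iff)
qed

lemma lookup_cat_alg_mult_idem:
  fixes x :: "'m \<Rightarrow>\<^sub>0 'k::field"
  assumes C: "is_category C" and X: "X \<in> Obj C" and x: "x \<in> cat_alg C"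
  shows "Poly_Mapping.lookup (cat_alg_mult C x (cat_alg_idem C X)) m =
    (if Dom C m = X then Poly_Mapping.lookup x m else 0)"
proof -
  have D: "Cod C (Id C X) = X"
    using C X by (auto simp: is_category_def)
  have I: "Comp C k (Id C X) = k" if "k \<in> Poly_Mapping.keys x" "Dom C k = X" for k
    using C x that by (auto simp: is_category_def cat_alg_def)
  have "cat_alg_mult C x (cat_alg_idem C X) =
      (\<Sum>k\<in>Poly_Mapping.keys x.
        if Dom C k = Cod C (Id C X) then Poly_Mapping.single (Comp C k (Id C X)) (Poly_Mapping.lookup x k) else 0)"
    unfolding cat_alg_mult_def cat_alg_idem_def keys_single by (simp cong: if_cong)
  also have "\<dots> =
      (\<Sum>k\<in>Poly_Mapping.keys x.
        if Dom C k = X then Poly_Mapping.single k (Poly_Mapping.lookup x k) else 0)"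
    by (intro sum.cong) (auto simp: D I)
  finally have "Poly_Mapping.lookup (cat_alg_mult C x (cat_alg_idem C X)) m =
      (\<Sum>k\<in>Poly_Mapping.keys x.
        if k = m then if Dom C m = X then Poly_Mapping.lookup x m else 0 else 0)"
    by (simp only: lookup_sum, intro sum.cong) (auto simp: lookup_single)
  then show ?thesis
    by (auto simp: in_keys_iff)
qed

text \<open>The map \<open>?corner\<close> is a projection: it erases all coefficients outside
  \<open>Hom C X Y\<close> and fixes every combination supported there, which is therefore its own
  preimage.\<close>

lemma cat_alg_idem_corner:
  assumes C: "is_category C" and X: "X \<in> Obj C" and Y: "Y \<in> Obj C"
  shows "{cat_alg_mult C (cat_alg_mult C (cat_alg_idem C Y) x) (cat_alg_idem C X) |x. x \<in> cat_alg C} =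
    {x :: 'm \<Rightarrow>\<^sub>0 'k::field. Poly_Mapping.keys x \<subseteq> Hom C X Y}"
    (is "{?corner x |x. x \<in> _} = _")
proof -
  have corner: "Poly_Mapping.lookup (?corner x) m =
      (if Dom C m = X \<and> Cod C m = Y then Poly_Mapping.lookup x m else 0)"
    if x: "x \<in> cat_alg C" for x :: "'m \<Rightarrow>\<^sub>0 'k" and m
  proof -
    \<comment> \<open>Needed before the right-hand filter can be applied to this product.\<close>
    have "cat_alg_mult C (cat_alg_idem C Y) x \<in> cat_alg C"
      using x by (auto simp: cat_alg_def in_keys_iff lookup_cat_alg_idem_mult[OF C Y x]
          split: if_splits)
    then show ?thesis
      by (simp add: lookup_cat_alg_mult_idem[OF C X] lookup_cat_alg_idem_mult[OF C Y x])
  qed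
  show ?thesis
  proof (intro equalityI subsetI)
    fix y :: "'m \<Rightarrow>\<^sub>0 'k" assume "y \<in> {?corner x |x. x \<in> cat_alg C}"
    then obtain x :: "'m \<Rightarrow>\<^sub>0 'k" where x: "x \<in> cat_alg C" and y: "y = ?corner x"
      by blast
    show "y \<in> {x. Poly_Mapping.keys x \<subseteq> Hom C X Y}"
      using x unfolding y
      by (auto simp: in_keys_iff corner[OF x] Hom_def cat_alg_def split: if_splits)
  next
    fix y :: "'m \<Rightarrow>\<^sub>0 'k" assume "y \<in> {x. Poly_Mapping.keys x \<subseteq> Hom C X Y}"
    then have keys: "Poly_Mapping.keys y \<subseteq> Hom C X Y"
      by simp
    then have y: "y \<in> cat_alg C"
      by (auto simp: cat_alg_def Hom_def)
    have "?corner y = y"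
      using keys by (intro poly_mapping_eqI) (auto simp: corner[OF y] Hom_def in_keys_iff)
    then show "y \<in> {?corner x |x. x \<in> cat_alg C}"
      using y by (auto intro!: exI[of _ y])
  qed
qed

text \<open>The vectors \<open>Poly_Mapping.single m 1\<close> with \<open>m\<close> in
  \<open>H\<close> form a basis. For infinite \<open>H\<close> both sides are 0 by
  convention.\<close>

lemma dim_keys_subset:
  "vector_space.dim cat_alg_scale {x :: 'm \<Rightarrow>\<^sub>0 'k::field. Poly_Mapping.keys x \<subseteq> H} = card H"
proof -
  interpret vector_space "cat_alg_scale :: 'k \<Rightarrow> ('m \<Rightarrow>\<^sub>0 'k) \<Rightarrow> _"
    by (rule vector_space_cat_alg_scale)
  let ?e = "\<lambda>m. Poly_Mapping.single m (1::'k)"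
  let ?V = "{x :: 'm \<Rightarrow>\<^sub>0 'k. Poly_Mapping.keys x \<subseteq> H}"
  have inj: "inj_on ?e S" for S
    by (auto simp: inj_on_def poly_mapping_eq_iff fun_eq_iff lookup_single when_def split: if_splits)
  \<comment> \<open>Reading off coefficients serves both halves of the basis proof: expanding
    \<open>x\<close> over its keys, and forcing the scalars of a vanishing combination to be
    0.\<close>
  have lookup_comb: "Poly_Mapping.lookup (\<Sum>m\<in>T. cat_alg_scale (c m) (?e m)) k =
      (if k \<in> T then c k else 0)" if "finite T" for T c k
  proof -
    have "Poly_Mapping.lookup (\<Sum>m\<in>T. cat_alg_scale (c m) (?e m)) k =
        (\<Sum>m\<in>T. if m = k then c k else 0)"
      by (auto simp: lookup_sum lookup_cat_alg_scale lookup_single when_def intro!: sum.cong)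
    then show ?thesis
      using that by simp
  qed
  have "card (?e ` H) = dim ?V"
  proof (rule basis_card_eq_dim)
    show "?e ` H \<subseteq> ?V"
      by auto
    show "?V \<subseteq> span (?e ` H)"
    proof
      fix x assume x: "x \<in> ?V"
      have "x = (\<Sum>m\<in>Poly_Mapping.keys x. cat_alg_scale (Poly_Mapping.lookup x m) (?e m))"
        by (rule poly_mapping_eqI) (simp add: lookup_comb in_keys_iff)
      also have "\<dots> \<in> span (?e ` H)"
        using x by (intro span_sum span_scale span_base) auto
      finally show "x \<in> span (?e ` H)" .
    qed
    show "independent (?e ` H)"
      unfolding independent_explicit_finite_subsets
    proof (intro allI impI ballI)
      fix S u v
      assume S: "S \<subseteq> ?e ` H" "finite S"
        and sum: "(\<Sum>v\<in>S. cat_alg_scale (u v) v) = 0" and v: "v \<in> S"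
      \<comment> \<open>Indexing the combination by morphisms instead of vectors makes
        \<open>lookup_comb\<close> applicable.\<close>
      obtain T where T: "T \<subseteq> H" "finite T" "S = ?e ` T"
        using finite_subset_image[OF S(2,1)] by blast
      obtain m where m: "m \<in> T" "v = ?e m"
        using v T(3) by blast
      have "(\<Sum>m\<in>T. cat_alg_scale (u (?e m)) (?e m)) = 0"
        using sum by (simp add: T(3) sum.reindex[OF inj])
      from arg_cong[OF this, of "\<lambda>x. Poly_Mapping.lookup x m"] show "u v = 0"
        using m T(2) by (simp add: lookup_comb)
    qed
  qed
  then show ?thesis
    by (simp add: card_image[OF inj])
qed

text \<open>The row index is the codomain, because the left idempotent is the one that selects
  codomains.\<close>

lemma cat_alg_cartan_matrix_eq_card_Hom:
  assumes "is_category C" "X \<in> Obj C" "Y \<in> Obj C"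
  shows "cat_alg_cartan_matrix TYPE('k::field) C (Y, X) = card (Hom C X Y)"
  using assms(2,3)
  by (simp add: cat_alg_cartan_matrix_def cartan_matrix_def cat_alg_idem_corner[OF assms]
      dim_keys_subset)

text \<open>These are the middle components of the triples in \<open>Hom (EF n) A B\<close>, freed
  of \<open>n\<close> so that the inversion below can range over all finite sets.\<close>

definition decreasing_onto :: "nat set \<Rightarrow> nat set \<Rightarrow> (nat \<Rightarrow> nat) set" where
  "decreasing_onto A B = {f \<in> extensional A. f ` A = B \<and> (\<forall>x\<in>A. f x \<le> x)}"

lemma card_Hom_EF:
  assumes "A \<subseteq> {1..n}" "B \<subseteq> {1..n}"
  shows "card (Hom (EF n) A B) = card (decreasing_onto A B)"
proof -
  have "Hom (EF n) A B = (\<lambda>f. (A, f, B)) ` decreasing_onto A B"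
    using assms by (auto simp: Hom_def EF_def decreasing_onto_def)
  then show ?thesis
    by (simp add: card_image inj_on_def)
qed

lemma sum_card_decreasing_onto:
  assumes A: "finite A" and S: "finite S"
  shows "(\<Sum>T\<in>Pow S. card (decreasing_onto A T)) = (\<Prod>i\<in>A. card {x \<in> S. x \<le> i})"
proof -
  have U: "(\<Union>T\<in>Pow S. decreasing_onto A T) = (\<Pi>\<^sub>E i\<in>A. {x \<in> S. x \<le> i})"
    by (simp add: set_eq_iff decreasing_onto_def PiE_iff) blast
  have "finite (\<Pi>\<^sub>E i\<in>A. {x \<in> S. x \<le> i})"
    using A S by (intro finite_PiE) auto
  then have "finite (decreasing_onto A T)" if "T \<in> Pow S" for T
    unfolding U[symmetric] using that by (meson UN_upper finite_subset)
  then have "card (\<Union>T\<in>Pow S. decreasing_onto A T) = (\<Sum>T\<in>Pow S. card (decreasing_onto A T))"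
    using S by (intro card_UN_disjoint) (auto simp: decreasing_onto_def)
  then show ?thesis
    by (simp add: U card_PiE[OF A])
qed

text \<open>This inverts \<open>sum_card_decreasing_onto\<close> over the subset lattice; the count
  is moved to \<open>int\<close> because of the signs.\<close>

lemma card_decreasing_onto:
  assumes "finite A" "finite B"
  shows "int (card (decreasing_onto A B)) =
    (\<Sum>X\<in>Pow B. (-1) ^ (card B - card X) * (\<Prod>i\<in>A. int (card {x \<in> X. x \<le> i})))"
proof (rule inclusion_exclusion_mobius[OF _ assms(2)])
  fix S :: "nat set" assume "finite S"
  from sum_card_decreasing_onto[OF assms(1) this]
  show "(\<Prod>i\<in>A. int (card {x \<in> S. x \<le> i})) = (\<Sum>T\<in>Pow S. int (card (decreasing_onto A T)))"
    by (simp flip: of_nat_sum of_nat_prod)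
qed

theorem lemma4p37:
  fixes n :: nat
  assumes "n \<ge> 1"
  shows "Obj (EF n) = Pow {1..n} \<and> card (Obj (EF n)) = 2 ^ n \<and>
    (\<forall>A B. A \<subseteq> {1..n} \<longrightarrow> B \<subseteq> {1..n} \<longrightarrow>
       int (cat_alg_cartan_matrix TYPE('k::field) (EF n) (B, A)) =
         (\<Sum>X\<in>Pow B. (-1) ^ (card B - card X) * (\<Prod>i\<in>A. int (card {x \<in> X. x \<le> i}))))"
proof (intro conjI allI impI)
  show obj: "Obj (EF n) = Pow {1..n}"
    by (simp add: EF_def)
  then show "card (Obj (EF n)) = 2 ^ n"
    by (simp add: card_Pow)
  fix A B assume AB: "A \<subseteq> {1..n}" "B \<subseteq> {1..n}"
  then have "finite A" "finite B"
    by (auto intro: finite_subset)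
  then show "int (cat_alg_cartan_matrix TYPE('k) (EF n) (B, A)) =
      (\<Sum>X\<in>Pow B. (-1) ^ (card B - card X) * (\<Prod>i\<in>A. int (card {x \<in> X. x \<le> i})))"
    using AB by (simp add: cat_alg_cartan_matrix_eq_card_Hom is_category_EF obj card_Hom_EF
        card_decreasing_onto)
qed

end
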